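(* Let $F$ be a baseline distribution function with density $f$ and, for $\beta>0$, let $G_{\beta,1}$ be the distribution function whose odds function is $\Lambda_{G_{\beta,1}}(x)=\beta\,\Lambda_F(x)$. Then: 1. If $\beta\le 1$, then $F\leq_{lr} G_{\beta,1}$. 2. If $\beta\ge 1$, then $G_{\beta,1}\leq_{lr} F$.
   Context: $\overline F=1-F$ and $\Lambda_F=F/\overline F$ is the odds function (equal to $+\infty$ where $\overline F=0$). Explicitly $G_{\beta,1}=\dfrac{\beta F}{\beta F+\overline F}$, with density $g_{\beta,1}=\dfrac{\beta f}{(\beta F+\overline F)^2}$. For distribution functions $F_1,F_2$ with densities $f_1,f_2$, $F_1\leq_{lr}F_2$ (likelihood ratio order) means that $f_2(x)/f_1(x)$ is (weakly) increasing in $x$, on the set where $f_1,f_2$ are not both zero. *)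

theory Defs
  imports "HOL-Probability.Probability"
begin

definition distribution_function :: "(real \<Rightarrow> real) \<Rightarrow> bool" where
  "distribution_function F \<longleftrightarrow> (\<exists>M. real_distribution M \<and> F = cdf M)"

definition has_density :: "(real \<Rightarrow> real) \<Rightarrow> (real \<Rightarrow> real) \<Rightarrow> bool" where
  "has_density F f \<longleftrightarrow>
     f \<in> borel_measurable borel \<and> (\<forall>x. 0 \<le> f x) \<and>
     real_distribution (density lborel f) \<and> F = cdf (density lborel f)"

definition odds :: "(real \<Rightarrow> real) \<Rightarrow> real \<Rightarrow> ennreal" where
  "odds F x = (if 1 - F x = 0 then \<infinity> else ennreal (F x / (1 - F x)))"

text \<open>The distribution function $G_{\beta,1}$; the description is proper for a distribution
  function \<open>F\<close> and \<open>\<beta> > 0\<close>, by \<open>odds_scaled_unique\<close> below.\<close>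

definition odds_scaled :: "real \<Rightarrow> (real \<Rightarrow> real) \<Rightarrow> real \<Rightarrow> real" where
  "odds_scaled \<beta> F =
     (THE G. distribution_function G \<and> (\<forall>x. odds G x = ennreal \<beta> * odds F x))"

definition odds_scaled_density :: "real \<Rightarrow> (real \<Rightarrow> real) \<Rightarrow> (real \<Rightarrow> real) \<Rightarrow> real \<Rightarrow> real" where
  "odds_scaled_density \<beta> F f x = \<beta> * f x / (\<beta> * F x + (1 - F x))\<^sup>2"

text \<open>The likelihood ratio order between \<open>F\<^sub>1\<close> with density \<open>f\<^sub>1\<close> and \<open>F\<^sub>2\<close> with density \<open>f\<^sub>2\<close>.
  The densities are arguments because monotonicity of the ratio depends on the chosen versions.
  The ratio is taken in \<open>ennreal\<close>, so that it is \<open>\<infinity>\<close> where \<open>f\<^sub>1\<close> vanishes and \<open>f\<^sub>2\<close> does not.\<close>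

definition lr_le ::
  "(real \<Rightarrow> real) \<Rightarrow> (real \<Rightarrow> real) \<Rightarrow> (real \<Rightarrow> real) \<Rightarrow> (real \<Rightarrow> real) \<Rightarrow> bool" where
  "lr_le F\<^sub>1 f\<^sub>1 F\<^sub>2 f\<^sub>2 \<longleftrightarrow>
     has_density F\<^sub>1 f\<^sub>1 \<and> has_density F\<^sub>2 f\<^sub>2 \<and>
     mono_on {x. \<not> (f\<^sub>1 x = 0 \<and> f\<^sub>2 x = 0)} (\<lambda>x. ennreal (f\<^sub>2 x) / ennreal (f\<^sub>1 x))"

lemma distribution_function_bounds:
  assumes "distribution_function F"
  shows "0 \<le> F x" "F x \<le> 1"
proof -
  obtain M where "real_distribution M" and F: "F = cdf M"
    using assms by (auto simp: distribution_function_def)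
  then interpret real_distribution M by simp
  show "0 \<le> F x" "F x \<le> 1"
    by (simp_all add: F cdf_nonneg cdf_bounded_prob)
qed

lemma odds_scaled_denom_pos:
  fixes \<beta> p :: real
  assumes "0 < \<beta>" "0 \<le> p" "p \<le> 1"
  shows "0 < \<beta> * p + (1 - p)"
proof (cases "p = 0")
  case False
  then have "0 < \<beta> * p" using assms by simp
  then show ?thesis using assms by linarith
qed simp

lemma distribution_function_odds_scaled_formula:
  assumes F: "distribution_function F" and \<beta>: "0 < \<beta>"
  shows "distribution_function (\<lambda>x. \<beta> * F x / (\<beta> * F x + (1 - F x)))" (is "distribution_function ?G")
proof -
  obtain M where M: "real_distribution M" and FM: "F = cdf M"
    using F by (auto simp: distribution_function_def)
  interpret real_distribution M by fact
  note b = distribution_function_bounds[OF F]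
  note pos = odds_scaled_denom_pos[OF \<beta> b]
  have mono: "?G x \<le> ?G y" if "x \<le> y" for x y
  proof -
    have "F x \<le> F y" using that by (simp add: FM cdf_nondecreasing)
    then have "\<beta> * F x \<le> \<beta> * F y" using \<beta> by simp
    then show ?thesis
      using pos[of x] pos[of y] by (simp add: field_simps)
  qed
  have cont: "continuous (at_right a) ?G" for a
  proof -
    have c: "continuous (at_right a) F" by (simp add: FM cdf_is_right_cont)
    show ?thesis
      unfolding continuous_within
      using c pos[of a] unfolding continuous_within
      by (intro tendsto_intros) auto
  qed
  have bot: "(?G \<longlongrightarrow> 0) at_bot"
  proof -
    have "(F \<longlongrightarrow> 0) at_bot" by (simp add: FM cdf_lim_at_bot)
    then have "(?G \<longlongrightarrow> \<beta> * 0 / (\<beta> * 0 + (1 - 0))) at_bot"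
      by (intro tendsto_intros) auto
    then show ?thesis by simp
  qed
  have top: "(?G \<longlongrightarrow> 1) at_top"
  proof -
    have "(F \<longlongrightarrow> 1) at_top" by (simp add: FM cdf_lim_at_top_prob)
    then have "(?G \<longlongrightarrow> \<beta> * 1 / (\<beta> * 1 + (1 - 1))) at_top"
      using \<beta> by (intro tendsto_intros) auto
    then show ?thesis using \<beta> by simp
  qed
  show ?thesis
    unfolding distribution_function_def
    using real_distribution_interval_measure[OF mono cont bot top]
      cdf_interval_measure[OF mono cont bot] by (metis (no_types, lifting))
qed

lemma odds_eq_scaled_iff:
  assumes F: "distribution_function F" and G: "distribution_function G" and \<beta>: "0 < \<beta>"
  shows "odds G x = ennreal \<beta> * odds F x \<longleftrightarrow> G x = \<beta> * F x / (\<beta> * F x + (1 - F x))"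
proof -
  note bF = distribution_function_bounds[OF F, of x]
  note bG = distribution_function_bounds[OF G, of x]
  note pos = odds_scaled_denom_pos[OF \<beta> bF]
  show ?thesis
  proof (cases "F x = 1")
    case True
    then show ?thesis using \<beta> by (simp add: odds_def ennreal_mult_top)
  next
    case F1: False
    have eq: "ennreal \<beta> * odds F x = ennreal (\<beta> * (F x / (1 - F x)))"
      using F1 \<beta> bF by (simp add: odds_def ennreal_mult[symmetric])
    show ?thesis
    proof (cases "G x = 1")
      case True
      then show ?thesis using F1 pos eq by (simp add: odds_def field_simps)
    next
      case False
      then have "odds G x = ennreal \<beta> * odds F x
          \<longleftrightarrow> G x / (1 - G x) = \<beta> * (F x / (1 - F x))"
        unfolding eq using F1 bF bG \<beta> by (simp add: odds_def)
      also have "\<dots> \<longleftrightarrow> G x * (1 - F x) = \<beta> * F x * (1 - G x)"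
        using F1 False by (simp add: field_simps)
      also have "\<dots> \<longleftrightarrow> G x = \<beta> * F x / (\<beta> * F x + (1 - F x))"
        using pos by (simp add: eq_divide_eq algebra_simps)
      finally show ?thesis .
    qed
  qed
qed

lemma odds_scaled_unique:
  assumes F: "distribution_function F" and \<beta>: "0 < \<beta>"
  shows "\<exists>!G. distribution_function G \<and> (\<forall>x. odds G x = ennreal \<beta> * odds F x)"
proof (rule ex1I)
  let ?G = "\<lambda>x. \<beta> * F x / (\<beta> * F x + (1 - F x))"
  show "distribution_function ?G \<and> (\<forall>x. odds ?G x = ennreal \<beta> * odds F x)"
    using distribution_function_odds_scaled_formula[OF F \<beta>] odds_eq_scaled_iff[OF F _ \<beta>, of ?G]
    by simp
  show "G = ?G" if "distribution_function G \<and> (\<forall>x. odds G x = ennreal \<beta> * odds F x)" for G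
    using that odds_eq_scaled_iff[OF F _ \<beta>, of G] by (simp add: fun_eq_iff)
qed

lemma odds_scaled_eq:
  assumes "distribution_function F" "0 < \<beta>"
  shows "odds_scaled \<beta> F x = \<beta> * F x / (\<beta> * F x + (1 - F x))"
  using theI'[OF odds_scaled_unique[OF assms]] odds_eq_scaled_iff[OF assms(1) _ assms(2)]
  unfolding odds_scaled_def by blast

end

theory Submission
  imports Defs
begin

text \<open>Write \<open>\<phi> p = \<beta> p / (\<beta> p + 1 - p)\<close>, so that \<open>G = \<phi> \<circ> F\<close> and \<open>g = (\<phi>' \<circ> F) \<cdot> f\<close>. Both orders hold
  because \<open>g / f = \<phi>' \<circ> F\<close> and \<open>\<phi>'\<close> is monotone. That \<open>g\<close> is a density of \<open>G\<close> needs an argument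
  since \<open>f\<close> is only measurable and need not be a pointwise derivative of \<open>F\<close>: as \<open>F\<close> is continuous,
  it pushes the measure \<open>f dx\<close> forward to the uniform distribution on \<open>[0, 1]\<close>, and there
  \<open>\<phi>\<close> is recovered from \<open>\<phi>'\<close> by the fundamental theorem of calculus.\<close>

text \<open>By continuity the cdf cannot jump over the level \<open>u\<close>. If
  \<open>u < 1\<close>, the sublevel set is either empty or a half-line \<open>{..x}\<close> whose
  right end satisfies \<open>cdf M x = u\<close>, so its probability is \<open>u\<close>.\<close>

lemma (in real_distribution) prob_cdf_le:
  assumes cont: "continuous_on UNIV (cdf M)" and u: "0 \<le> u" "u \<le> 1"
  shows "prob {y. cdf M y \<le> u} = u"
proof (cases "u = 1")
  case True
  then have "{y. cdf M y \<le> u} = space M"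
    by (auto simp: cdf_bounded_prob)
  then show ?thesis
    using prob_space True by simp
next
  case False
  define S where "S = {y. cdf M y \<le> u}"
  \<comment> \<open>Since the cdf tends to 1, a level below 1 is exceeded at some \<open>b\<close>,
    which bounds \<open>S\<close> above and makes its supremum available.\<close>
  have "u < 1" using False u by simp
  then have "eventually (\<lambda>y. u < cdf M y) at_top"
    using cdf_lim_at_top_prob order_tendstoD(1) by blast
  then obtain b where b: "u < cdf M b"
    by (meson eventually_happens trivial_limit_at_top_linorder)
  have bdd: "y \<le> b" if "y \<in> S" for y
    using that b cdf_nondecreasing[of b y] unfolding S_def by force
  have "closed S"
    unfolding S_def by (intro closed_Collect_le cont continuous_intros)
  show ?thesis
  proof (cases "S = {}")
    case True
    \<comment> \<open>Only level 0 can have an empty sublevel set, because the cdf tends to 0 at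
      minus infinity.\<close>
    have "u = 0"
    proof (rule ccontr)
      assume "u \<noteq> 0"
      then have "eventually (\<lambda>y. cdf M y < u) at_bot"
        using u cdf_lim_at_bot order_tendstoD(2)[of "cdf M" 0 at_bot u] by simp
      then obtain y where "cdf M y < u"
        by (meson eventually_happens trivial_limit_at_bot_linorder)
      then have "y \<in> S" by (simp add: S_def)
      then show False using True by simp
    qed
    then show ?thesis using True unfolding S_def by simp
  next
    case False
    define x where "x = Sup S"
    have bS: "bdd_above S" using bdd by (meson bdd_aboveI)
    have xS: "x \<in> S"
      unfolding x_def by (intro closed_contains_Sup False bS \<open>closed S\<close>)
    have S: "S = {..x}"
    proof
      show "S \<subseteq> {..x}" using bS by (auto simp: x_def intro: cSup_upper)
      show "{..x} \<subseteq> S" using xS cdf_nondecreasing[of _ x] unfolding S_def by force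
    qed
    \<comment> \<open>A priori only \<open>cdf M x \<le> u\<close>. The intermediate value theorem
      gives a point of \<open>S\<close> at or beyond \<open>x\<close> where equality holds; by
      maximality that point is \<open>x\<close>.\<close>
    obtain z where z: "x \<le> z" "cdf M z = u"
      using IVT'[of "cdf M" x u b] xS b bdd[OF xS] continuous_on_subset[OF cont]
      unfolding S_def by auto
    then have "z \<in> S" by (simp add: S_def)
    then have "z = x" using S z(1) by auto
    then show ?thesis using z S by (simp add: cdf_def S_def)
  qed
qed

text \<open>The probability integral transform: both measures have the cdf that clamps
  \<open>u\<close> to the unit interval.\<close>

lemma (in real_distribution) distr_cdf_uniform:
  assumes cont: "continuous_on UNIV (cdf M)"
  shows "distr M borel (cdf M) = uniform_measure lborel {0..1}"
proof (rule cdf_unique)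
  have meas [measurable]: "cdf M \<in> borel_measurable borel"
    by (intro borel_measurable_continuous_onI cont)
  show "real_distribution (distr M borel (cdf M))"
    by (intro real_distribution_distr) simp
  have U: "prob_space (uniform_measure lborel {0..1::real})"
    by (intro prob_space_uniform_measure) auto
  then show "real_distribution (uniform_measure lborel {0..1})"
    by (simp add: real_distribution_def real_distribution_axioms_def)
  show "cdf (distr M borel (cdf M)) = cdf (uniform_measure lborel {0..1})"
  proof
    fix u :: real
    have "cdf (distr M borel (cdf M)) u = prob {y. cdf M y \<le> u}"
      unfolding cdf_def[of "distr M borel (cdf M)"]
      by (subst measure_distr) (auto simp: vimage_def)
    also have "\<dots> = max 0 (min 1 u)"
    proof -
      consider "u < 0" | "0 \<le> u" "u \<le> 1" | "1 < u" by linarith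
      then show ?thesis
      proof cases
        case 1
        then have "{y. cdf M y \<le> u} = {}"
          using cdf_nonneg by (auto simp: not_le intro: less_le_trans)
        then show ?thesis using 1 by simp
      next
        case 2
        then show ?thesis by (simp add: prob_cdf_le[OF cont])
      next
        case 3
        then have "{y. cdf M y \<le> u} = space M"
          by (auto intro: order_trans[OF cdf_bounded_prob])
        then show ?thesis using 3 prob_space by simp
      qed
    qed
    also have "\<dots> = measure lborel ({0..1} \<inter> {..u}) / measure lborel {0..1::real}"
    proof -
      have "{0..1} \<inter> {..u} = {0..min 1 u}" by auto
      then show ?thesis by (simp add: max_def)
    qed
    also have "\<dots> = cdf (uniform_measure lborel {0..1}) u"
      unfolding cdf_def by (subst measure_uniform_measure) auto
    finally show "cdf (distr M borel (cdf M)) u = cdf (uniform_measure lborel {0..1}) u" .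
  qed
qed

text \<open>The region is a sublevel set of the cdf and not a half-line because it is then exactly
  the preimage of \<open>{..p}\<close>, so the integrand depends on \<open>y\<close> only through
  \<open>cdf M y\<close> and the integral can be moved to the unit interval.\<close>

lemma (in real_distribution) nn_integral_cdf_le:
  assumes cont: "continuous_on UNIV (cdf M)"
    and h [measurable]: "h \<in> borel_measurable borel"
    and der: "\<And>u. 0 \<le> u \<Longrightarrow> u \<le> 1 \<Longrightarrow> (\<phi> has_real_derivative h u) (at u)"
    and nonneg: "\<And>u. 0 \<le> u \<Longrightarrow> u \<le> 1 \<Longrightarrow> 0 \<le> h u"
    and p: "0 \<le> p" "p \<le> 1"
  shows "(\<integral>\<^sup>+y. ennreal (h (cdf M y)) * indicator {y. cdf M y \<le> p} y \<partial>M) = ennreal (\<phi> p - \<phi> 0)"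
proof -
  have meas [measurable]: "cdf M \<in> borel_measurable borel"
    by (intro borel_measurable_continuous_onI cont)
  have "(\<integral>\<^sup>+y. ennreal (h (cdf M y)) * indicator {y. cdf M y \<le> p} y \<partial>M)
      = (\<integral>\<^sup>+u. ennreal (h u) * indicator {..p} u \<partial>distr M borel (cdf M))"
    by (subst nn_integral_distr) (auto simp: indicator_def intro!: nn_integral_cong)
  also have "\<dots> = (\<integral>\<^sup>+u. ennreal (h u) * indicator {..p} u * indicator {0..1} u \<partial>lborel)"
    unfolding distr_cdf_uniform[OF cont]
    by (subst nn_integral_uniform_measure) (auto simp: divide_ennreal_def)
  also have "\<dots> = (\<integral>\<^sup>+u. ennreal (h u) * indicator {0..p} u \<partial>lborel)"
    using p by (auto simp: indicator_def intro!: nn_integral_cong)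
  also have "\<dots> = ennreal (\<phi> p - \<phi> 0)"
    using p by (intro nn_integral_FTC_Icc der nonneg DERIV_subset[OF der]) auto
  finally show ?thesis .
qed

text \<open>The candidate measure \<open>N\<close> is evaluated on sublevel sets of
  \<open>F\<close>, where the change of variables is exact; these differ from half-lines only by
  null sets.\<close>

lemma has_density_compose:
  assumes dens: "has_density F f"
    and h [measurable]: "h \<in> borel_measurable borel"
    and der: "\<And>u. 0 \<le> u \<Longrightarrow> u \<le> 1 \<Longrightarrow> (\<phi> has_real_derivative h u) (at u)"
    and nonneg: "\<And>u. 0 \<le> u \<Longrightarrow> u \<le> 1 \<Longrightarrow> 0 \<le> h u"
    and \<phi>: "\<phi> 0 = 0" "\<phi> 1 = 1"
  shows "has_density (\<lambda>x. \<phi> (F x)) (\<lambda>x. h (F x) * f x)"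
proof -
  define M where "M = density lborel f"
  have f [measurable]: "f \<in> borel_measurable borel" and f0: "\<And>x. 0 \<le> f x"
    and M: "real_distribution M" and F: "F = cdf M"
    using dens by (auto simp: has_density_def M_def)
  interpret real_distribution M by fact
  \<comment> \<open>A measure with a Lebesgue density has no atoms, hence its cdf is
    continuous.\<close>
  have null: "measure M {x} = 0" for x
  proof -
    have "emeasure M {x} = 0"
      unfolding M_def by (subst emeasure_density) (auto simp: nn_integral_cmult_indicator)
    then show ?thesis by (simp add: measure_def)
  qed
  have cont: "continuous_on UNIV (cdf M)"
    using null by (simp add: continuous_on_eq_continuous_at isCont_cdf)
  have meas [measurable]: "F \<in> borel_measurable borel"
    unfolding F by (intro borel_measurable_continuous_onI cont)
  have F01: "0 \<le> F x" "F x \<le> 1" for x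
    by (simp_all add: F cdf_nonneg cdf_bounded_prob)
  have \<phi>0: "0 \<le> \<phi> p" if "0 \<le> p" "p \<le> 1" for p
    using DERIV_nonneg_imp_nondecreasing[of 0 p \<phi>] der nonneg that \<phi> order_trans by metis
  define N where "N = density lborel (\<lambda>x. ennreal (h (F x) * f x))"
  \<comment> \<open>Absorbing \<open>f\<close> into \<open>M\<close> shows that \<open>N\<close> has
    density \<open>h \<circ> F\<close> relative to \<open>M\<close>; in particular
    \<open>M\<close>-null sets are \<open>N\<close>-null.\<close>
  have N_eq: "emeasure N A = (\<integral>\<^sup>+y. ennreal (h (F y)) * indicator A y \<partial>M)"
    if [measurable]: "A \<in> sets borel" for A
    unfolding N_def M_def using F01 nonneg f0
    by (subst emeasure_density, simp, simp, subst nn_integral_density)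
       (auto simp: ennreal_mult mult_ac intro!: nn_integral_cong)
  have N_level: "emeasure N {y. F y \<le> p} = ennreal (\<phi> p)" if "0 \<le> p" "p \<le> 1" for p
    using nn_integral_cdf_le[OF cont h der nonneg that] by (simp add: N_eq \<phi> flip: F)
  have "emeasure N UNIV = 1"
    using N_level[of 1] F01 \<phi> by simp
  then have "prob_space N"
    by (intro prob_spaceI) (simp add: N_def)
  then have N: "real_distribution N"
    by (simp add: real_distribution_def real_distribution_axioms_def N_def)
  have "cdf N x = \<phi> (F x)" for x
  proof -
    \<comment> \<open>The inclusion is strict when \<open>F\<close> stays constant to the right of
      \<open>x\<close>, but both sets have \<open>M\<close>-measure \<open>F x\<close>.\<close>
    have sub: "{..x} \<subseteq> {y. F y \<le> F x}"
      by (auto simp: F cdf_nondecreasing)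
    have "measure M ({y. F y \<le> F x} - {..x}) = measure M {y. F y \<le> F x} - measure M {..x}"
      using sub by (intro finite_measure_Diff) auto
    also have "\<dots> = 0"
      using prob_cdf_le[OF cont, of "F x"] F01 by (simp add: F cdf_def)
    finally have "AE y in M. y \<notin> {y. F y \<le> F x} - {..x}"
      by (intro AE_not_in) (simp add: null_sets_def emeasure_eq_measure)
    then have "emeasure N {..x} = emeasure N {y. F y \<le> F x}"
      using sub by (auto simp: N_eq indicator_def intro!: nn_integral_cong_AE elim!: eventually_mono)
    also have "\<dots> = ennreal (\<phi> (F x))"
      using N_level F01 by simp
    finally show ?thesis
      using \<phi>0 F01 by (simp add: cdf_def measure_def)
  qed
  then show ?thesis
    using N F01 nonneg f0 unfolding has_density_def N_def[symmetric]
    by (auto simp: fun_eq_iff)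
qed

lemma has_density_distribution_function: "has_density F f \<Longrightarrow> distribution_function F"
  unfolding has_density_def distribution_function_def by auto

lemma has_density_odds_scaled:
  assumes "has_density F f" and "0 < \<beta>"
  shows "has_density (odds_scaled \<beta> F) (odds_scaled_density \<beta> F f)"
proof -
  let ?\<phi> = "\<lambda>p. \<beta> * p / (\<beta> * p + (1 - p))" and ?h = "\<lambda>p. \<beta> / (\<beta> * p + (1 - p))\<^sup>2"
  have der: "(?\<phi> has_real_derivative ?h u) (at u)" if "0 \<le> u" "u \<le> 1" for u
    using odds_scaled_denom_pos[OF \<open>0 < \<beta>\<close> that]
    by (auto intro!: derivative_eq_intros simp: power2_eq_square algebra_simps)
  have "has_density (\<lambda>x. ?\<phi> (F x)) (\<lambda>x. ?h (F x) * f x)"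
    using assms(2) by (intro has_density_compose[OF assms(1) _ der]) auto
  moreover have "odds_scaled \<beta> F = (\<lambda>x. ?\<phi> (F x))"
    using odds_scaled_eq[OF has_density_distribution_function[OF assms(1)] assms(2)] by auto
  moreover have "odds_scaled_density \<beta> F f = (\<lambda>x. ?h (F x) * f x)"
    by (auto simp: odds_scaled_density_def)
  ultimately show ?thesis by simp
qed

theorem theorem3p4:
  fixes F f :: "real \<Rightarrow> real" and \<beta> :: real
  assumes "has_density F f" and "\<beta> > 0"
  shows "(\<beta> \<le> 1 \<longrightarrow> lr_le F f (odds_scaled \<beta> F) (odds_scaled_density \<beta> F f)) \<and>
         (\<beta> \<ge> 1 \<longrightarrow> lr_le (odds_scaled \<beta> F) (odds_scaled_density \<beta> F f) F f)"
proof -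
  let ?d = "\<lambda>x. \<beta> * F x + (1 - F x)" and ?g = "odds_scaled_density \<beta> F f"
  have dF: "distribution_function F"
    using has_density_distribution_function[OF assms(1)] .
  note F01 = distribution_function_bounds[OF dF]
  have d: "0 < ?d x" for x
    using odds_scaled_denom_pos[OF assms(2) F01] .
  have f0: "0 \<le> f x" for x
    using assms(1) by (simp add: has_density_def)
  have mono: "F x \<le> F y" if "x \<le> y" for x y
  proof -
    obtain M where M: "real_distribution M" "F = cdf M"
      using dF by (auto simp: distribution_function_def)
    interpret real_distribution M by fact
    show ?thesis using that M by (simp add: cdf_nondecreasing)
  qed
  \<comment> \<open>Both densities have the same zeros, so on the set of the order neither vanishes
    and the ratios are finite.\<close>
  have g0: "?g x = 0 \<longleftrightarrow> f x = 0" for x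
    using d[of x] assms(2) by (simp add: odds_scaled_density_def)
  have gf: "ennreal (?g x) / ennreal (f x) = ennreal (\<beta> / (?d x)\<^sup>2)"
    and fg: "ennreal (f x) / ennreal (?g x) = ennreal ((?d x)\<^sup>2 / \<beta>)" if "f x \<noteq> 0" for x
    using d[of x] assms(2) f0[of x] that
    by (auto simp: odds_scaled_density_def divide_ennreal field_simps)
  have "mono_on {x. \<not> (f x = 0 \<and> ?g x = 0)} (\<lambda>x. ennreal (?g x) / ennreal (f x))" if "\<beta> \<le> 1"
  proof (rule mono_onI)
    fix r s assume rs: "r \<in> {x. \<not> (f x = 0 \<and> ?g x = 0)}" "s \<in> {x. \<not> (f x = 0 \<and> ?g x = 0)}" "r \<le> s"
    \<comment> \<open>The denominator is \<open>1 - (1 - \<beta>) * F x\<close>, which decreases in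
      \<open>x\<close> for \<open>\<beta> \<le> 1\<close>; for \<open>\<beta> \<ge> 1\<close> it
      increases.\<close>
    have "?d s \<le> ?d r"
      using mult_left_mono[OF mono[OF rs(3)], of "1 - \<beta>"] that by (simp add: algebra_simps)
    then have "\<beta> / (?d r)\<^sup>2 \<le> \<beta> / (?d s)\<^sup>2"
      using d[of s] d[of r] assms(2) by (intro divide_left_mono power_mono mult_pos_pos) auto
    then show "ennreal (?g r) / ennreal (f r) \<le> ennreal (?g s) / ennreal (f s)"
      using rs g0 by (simp add: gf ennreal_leI)
  qed
  moreover have "mono_on {x. \<not> (?g x = 0 \<and> f x = 0)} (\<lambda>x. ennreal (f x) / ennreal (?g x))" if "1 \<le> \<beta>"
  proof (rule mono_onI)
    fix r s assume rs: "r \<in> {x. \<not> (?g x = 0 \<and> f x = 0)}" "s \<in> {x. \<not> (?g x = 0 \<and> f x = 0)}" "r \<le> s"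
    have "?d r \<le> ?d s"
      using mult_left_mono[OF mono[OF rs(3)], of "\<beta> - 1"] that by (simp add: algebra_simps)
    then have "(?d r)\<^sup>2 / \<beta> \<le> (?d s)\<^sup>2 / \<beta>"
      using d[of r] assms(2) by (intro divide_right_mono power_mono) auto
    then show "ennreal (f r) / ennreal (?g r) \<le> ennreal (f s) / ennreal (?g s)"
      using rs g0 by (simp add: fg ennreal_leI)
  qed
  ultimately show ?thesis
    using assms(1) has_density_odds_scaled[OF assms] by (simp add: lr_le_def)
qed

end
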